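(* Let $y\in\{0,1\}$ be a random variable (the ground truth) with prior $p=\Pr[y=1]$, let $o_i$ be an agent's private signal with values in a finite set, and let $p_i=\Pr[y=1\mid o_i]$ be the agent's posterior. Let $z\in\{0,1\}$ be a noisy ground truth with error rates $e_z^+=\Pr[z=0\mid y=1]$ and $e_z^-=\Pr[z=1\mid y=0]$. Suppose that $z$ and $o_i$ are independent conditional on $y$, and that $z$ is stochastically relevant for $y$. Let $R$ be a surrogate scoring rule. Then $R(\cdot,z)$ (used with the error rates $e_z^+,e_z^-$) is strictly proper for eliciting the posterior $p_i$: for every realization of $o_i$ (of positive probability) and every $q_i\in[0,1]$ with $q_i\ne p_i$, $$\mathbb E_{z\mid o_i}[R(p_i,z)]>\mathbb E_{z\mid o_i}[R(q_i,z)].$$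
   Context: Strictly proper scoring rule (SPSR): a function $S:[0,1]\times\{0,1\}\to\mathbb R$ such that for all $p\neq q$ in $[0,1]$, $\mathbb E_{y\sim \mathrm{Bernoulli}(p)}[S(p,y)]>\mathbb E_{y\sim \mathrm{Bernoulli}(p)}[S(q,y)]$. Surrogate scoring rule (SSR): a function $R(q,z)$ of a report $q\in[0,1]$ and $z\in\{0,1\}$, which may also depend on error rates $(e_z^+,e_z^-)\in[0,1]^2$ with $e_z^++e_z^-\neq1$, is a surrogate scoring rule if there exist a strictly proper scoring rule $S$ and a strictly increasing function $f$ (real-valued, defined on the values of the expected score) such that for all $p',q\in[0,1]$ and all $e_z^+,e_z^-\in[0,1]$ with $e_z^++e_z^-\ne1$, $$\mathbb E_z[R(q,z)]=f\big(\mathbb E_y[S(q,y)]\big),$$ where $y\sim\mathrm{Bernoulli}(p')$ and $z$ is generated from $y$ with $\Pr[z=0\mid y=1]=e_z^+$, $\Pr[z=1\mid y=0]=e_z^-$. Stochastic relevance: $z$ is stochastically relevant for $y$ if the distribution of $y$ conditioned on $z$ is different for the different realizations of $z$ (i.e. both realizations have positive probability and $\Pr[y=1\mid z=0]\ne\Pr[y=1\mid z=1]$). *)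

theory Defs
  imports "HOL-Probability.Probability"
begin

text \<open>
  Binary outcomes in \<open>{0,1}\<close> are booleans, with \<open>True\<close> for 1 and \<open>False\<close> for 0, so that
  \<^const>\<open>bernoulli_pmf\<close> applies directly. Scoring rules are total functions on the reals;
  only their values at reports in \<open>{0..1}\<close> are ever constrained or used.
\<close>

definition expected_score :: "(real \<Rightarrow> bool \<Rightarrow> real) \<Rightarrow> real \<Rightarrow> real \<Rightarrow> real" where
  "expected_score S p q = measure_pmf.expectation (bernoulli_pmf p) (S q)"

definition strictly_proper_scoring_rule :: "(real \<Rightarrow> bool \<Rightarrow> real) \<Rightarrow> bool" where
  "strictly_proper_scoring_rule S \<longleftrightarrow>
     (\<forall>p\<in>{0..1}. \<forall>q\<in>{0..1}. p \<noteq> q \<longrightarrow> expected_score S p p > expected_score S p q)"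

text \<open>
  The law of \<open>z\<close> when \<open>y\<close> is Bernoulli(\<open>p\<close>), \<open>ep = Pr[z=0 | y=1]\<close> and \<open>em = Pr[z=1 | y=0]\<close>.
\<close>

definition noisy_pmf :: "real \<Rightarrow> real \<Rightarrow> real \<Rightarrow> bool pmf" where
  "noisy_pmf ep em p =
     bind_pmf (bernoulli_pmf p) (\<lambda>y. if y then bernoulli_pmf (1 - ep) else bernoulli_pmf em)"

text \<open>
  \<open>R ep em q z\<close> is the score of report \<open>q\<close> against \<open>z\<close>, given the error rates \<open>ep\<close>, \<open>em\<close>.
  Both \<open>S\<close> and \<open>f\<close> are chosen before \<open>p\<close>, \<open>q\<close> and the error rates. The function \<open>f\<close> need only
  be strictly increasing on the set of attained values of the expected score.
\<close>

definition surrogate_scoring_rule :: "(real \<Rightarrow> real \<Rightarrow> real \<Rightarrow> bool \<Rightarrow> real) \<Rightarrow> bool" where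
  "surrogate_scoring_rule R \<longleftrightarrow>
     (\<exists>S f. strictly_proper_scoring_rule S \<and>
        strict_mono_on {expected_score S p q | p q. p \<in> {0..1} \<and> q \<in> {0..1}} f \<and>
        (\<forall>p\<in>{0..1}. \<forall>q\<in>{0..1}. \<forall>ep\<in>{0..1}. \<forall>em\<in>{0..1}. ep + em \<noteq> 1 \<longrightarrow>
           measure_pmf.expectation (noisy_pmf ep em p) (R ep em q) = f (expected_score S p q)))"

definition stochastically_relevant :: "'a measure \<Rightarrow> ('a \<Rightarrow> bool) \<Rightarrow> ('a \<Rightarrow> bool) \<Rightarrow> bool" where
  "stochastically_relevant M z y \<longleftrightarrow>
     \<P>(\<omega> in M. z \<omega>) > 0 \<and> \<P>(\<omega> in M. \<not> z \<omega>) > 0 \<and>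
     \<P>(\<omega> in M. y \<omega> \<bar> \<not> z \<omega>) \<noteq> \<P>(\<omega> in M. y \<omega> \<bar> z \<omega>)"

definition cond_indep_discrete ::
  "'a measure \<Rightarrow> ('a \<Rightarrow> 'b) \<Rightarrow> ('a \<Rightarrow> 'c) \<Rightarrow> ('a \<Rightarrow> 'd) \<Rightarrow> bool" where
  "cond_indep_discrete M X Z Y \<longleftrightarrow>
     (\<forall>a b c. \<P>(\<omega> in M. Y \<omega> = c) > 0 \<longrightarrow>
        \<P>(\<omega> in M. X \<omega> = a \<and> Z \<omega> = b \<bar> Y \<omega> = c) =
        \<P>(\<omega> in M. X \<omega> = a \<bar> Y \<omega> = c) * \<P>(\<omega> in M. Z \<omega> = b \<bar> Y \<omega> = c))"

text \<open>
  The expectation of \<open>X\<close> under \<open>M\<close> conditioned on the event \<open>P\<close>; meaningful only when the event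
  has positive probability.
\<close>

definition event_expectation :: "'a measure \<Rightarrow> ('a \<Rightarrow> bool) \<Rightarrow> ('a \<Rightarrow> real) \<Rightarrow> real" where
  "event_expectation M P X = integral\<^sup>L (uniform_measure M {\<omega> \<in> space M. P \<omega>}) X"

end

theory Submission
  imports Defs
begin

text \<open>
  Conditioned on the signal, \<open>z\<close> is Bernoulli with parameter
  \<open>(1 - ep) * p\<^sub>i + em * (1 - p\<^sub>i)\<close>, by conditional independence. This is the law of the noisy
  outcome with prior \<open>p\<^sub>i\<close>, so the defining equation of a surrogate scoring rule applies with prior
  \<open>p\<^sub>i\<close>. Its side condition \<open>ep + em \<noteq> 1\<close> is what stochastic relevance provides: both say that the
  determinant of the joint distribution of \<open>(y, z)\<close> does not vanish.
\<close>

lemma noisy_pmf_eq_bernoulli: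
  assumes "ep \<in> {0..1}" "em \<in> {0..1}" "p \<in> {0..1}"
  shows "noisy_pmf ep em p = bernoulli_pmf ((1 - ep) * p + em * (1 - p))"
proof (rule pmf_eqI)
  fix b
  \<comment> \<open>The parameter is a convex combination of \<open>1 - ep\<close> and
    \<open>em\<close>. Both bounds are proved because \<open>bernoulli_pmf\<close> clamps its
    argument to the unit interval, so its \<open>pmf\<close> equals the parameter only inside
    it.\<close>
  have "(1 - ep) * p + em * (1 - p) \<le> 1 * p + 1 * (1 - p)"
    using assms by (intro add_mono mult_right_mono) auto
  moreover have "0 \<le> (1 - ep) * p + em * (1 - p)"
    using assms by auto
  ultimately show "pmf (noisy_pmf ep em p) b = pmf (bernoulli_pmf ((1 - ep) * p + em * (1 - p))) b"
    using assms by (cases b) (auto simp: noisy_pmf_def pmf_bind algebra_simps)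
qed

text \<open>For fixed prior and rates the same \<open>S\<close> and \<open>f\<close> govern both
  reports, so the strictly increasing \<open>f\<close> carries the strict inequality for
  \<open>S\<close> over to \<open>R\<close>.\<close>

lemma surrogate_scoring_rule_strictly_proper:
  assumes "surrogate_scoring_rule R"
    and "p \<in> {0..1}" "q \<in> {0..1}" "q \<noteq> p"
    and "ep \<in> {0..1}" "em \<in> {0..1}" "ep + em \<noteq> 1"
  shows "measure_pmf.expectation (noisy_pmf ep em p) (R ep em p)
           > measure_pmf.expectation (noisy_pmf ep em p) (R ep em q)"
proof -
  obtain S f where S: "strictly_proper_scoring_rule S"
    and f: "strict_mono_on {expected_score S p q | p q. p \<in> {0..1} \<and> q \<in> {0..1}} f"
    and R: "\<forall>p\<in>{0..1}. \<forall>q\<in>{0..1}. \<forall>ep\<in>{0..1}. \<forall>em\<in>{0..1}. ep + em \<noteq> 1 \<longrightarrow>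
      measure_pmf.expectation (noisy_pmf ep em p) (R ep em q) = f (expected_score S p q)"
    using assms(1) unfolding surrogate_scoring_rule_def by (elim exE conjE)
  have "expected_score S p q < expected_score S p p"
    using S assms(2-4) by (simp add: strictly_proper_scoring_rule_def)
  then have "f (expected_score S p q) < f (expected_score S p p)"
    using assms(2,3) by (intro strict_mono_onD[OF f]) auto
  then show ?thesis
    using assms(2,3,5-7) R by simp
qed

context prob_space
begin

lemma cond_prob_in_unit_interval:
  assumes [measurable]: "Measurable.pred M P" "Measurable.pred M Q"
  shows "cond_prob M P Q \<in> {0..1}"
proof -
  have "prob {\<omega> \<in> space M. P \<omega> \<and> Q \<omega>} \<le> prob {\<omega> \<in> space M. Q \<omega>}"
    by (intro finite_measure_mono) auto
  \<comment> \<open>Division by zero yields 0, so the bounds persist when the condition is a null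
    event.\<close>
  moreover have "a / b \<in> {0..1}" if "0 \<le> a" "a \<le> b" for a b :: real
    using that by (cases "b = 0") simp_all
  ultimately show ?thesis
    unfolding cond_prob_def using measure_nonneg by blast
qed

lemma prob_conj_split:
  assumes [measurable]: "Measurable.pred M P" "Measurable.pred M Q"
  shows "\<P>(\<omega> in M. Q \<omega>) = \<P>(\<omega> in M. P \<omega> \<and> Q \<omega>) + \<P>(\<omega> in M. \<not> P \<omega> \<and> Q \<omega>)"
proof -
  have "{\<omega> \<in> space M. Q \<omega>} =
      {\<omega> \<in> space M. P \<omega> \<and> Q \<omega>} \<union> {\<omega> \<in> space M. \<not> P \<omega> \<and> Q \<omega>}"
    by auto
  then show ?thesis
    by (simp add: finite_measure_Union disjoint_iff)
qed

lemma cond_prob_not: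
  assumes [measurable]: "Measurable.pred M P" "Measurable.pred M Q"
    and "\<P>(\<omega> in M. Q \<omega>) > 0"
  shows "cond_prob M (\<lambda>\<omega>. \<not> P \<omega>) Q = 1 - cond_prob M P Q"
proof -
  have "\<P>(\<omega> in M. \<not> P \<omega> \<and> Q \<omega>) = \<P>(\<omega> in M. Q \<omega>) - \<P>(\<omega> in M. P \<omega> \<and> Q \<omega>)"
    using prob_conj_split[of P Q] by simp
  then show ?thesis
    using assms(3) by (simp add: cond_prob_def diff_divide_distrib)
qed

text \<open>A function of a boolean is affine in its indicator, so its conditional mean depends only
  on the conditional probability of \<open>z\<close>. This replaces integrals over \<open>M\<close>
  by integrals over a pmf.\<close>

lemma event_expectation_bool:
  fixes g :: "bool \<Rightarrow> real"
  assumes [measurable]: "Measurable.pred M z" "Measurable.pred M P"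
    and pos: "\<P>(\<omega> in M. P \<omega>) > 0"
  shows "event_expectation M P (\<lambda>\<omega>. g (z \<omega>)) =
    measure_pmf.expectation (bernoulli_pmf (cond_prob M z P)) g"
proof -
  let ?A = "{\<omega> \<in> space M. P \<omega>}"
  let ?U = "uniform_measure M ?A"
  interpret U: prob_space ?U
    using pos by (intro prob_space_uniform_measure) (auto simp: emeasure_eq_measure)
  \<comment> \<open>Integrability needs the indicator's set to have finite mass.
    \<open>emeasure_uniform_measure\<close> is deleted so that the mass is rewritten to a real
    number, not to a quotient.\<close>
  have Z: "integrable ?U (indicat_real {\<omega> \<in> space M. z \<omega>})"
    by (intro integrable_real_indicator) (simp_all add: U.emeasure_eq_measure del: emeasure_uniform_measure)
  have "event_expectation M P (\<lambda>\<omega>. g (z \<omega>)) =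
      (\<integral>\<omega>. g False + (g True - g False) * indicator {\<omega> \<in> space M. z \<omega>} \<omega> \<partial>?U)"
    unfolding event_expectation_def
    by (intro Bochner_Integration.integral_cong) (auto simp: indicator_def)
  also have "\<dots> = g False + (g True - g False) * measure ?U {\<omega> \<in> space M. z \<omega>}"
    using Z U.prob_space by simp
  also have "measure ?U {\<omega> \<in> space M. z \<omega>} = cond_prob M z P"
  proof -
    have "?A \<inter> {\<omega> \<in> space M. z \<omega>} = {\<omega> \<in> space M. z \<omega> \<and> P \<omega>}"
      by auto
    then show ?thesis
      using pos by (simp add: cond_prob_def measure_uniform_measure emeasure_eq_measure)
  qed
  finally show ?thesis
    using cond_prob_in_unit_interval[of z P] by (simp add: algebra_simps)
qed

lemma stochastically_relevant_nondegenerate: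
  assumes [measurable]: "Measurable.pred M y" "Measurable.pred M z"
    and rel: "stochastically_relevant M z y"
  shows "\<P>(\<omega> in M. y \<omega>) > 0" "\<P>(\<omega> in M. \<not> y \<omega>) > 0"
    and "\<P>(\<omega> in M. \<not> z \<omega> \<bar> y \<omega>) + \<P>(\<omega> in M. z \<omega> \<bar> \<not> y \<omega>) \<noteq> 1"
proof -
  \<comment> \<open>The four cells of the joint distribution: rows are the values of
    \<open>y\<close>, columns those of \<open>z\<close>.\<close>
  define a where "a = \<P>(\<omega> in M. y \<omega> \<and> z \<omega>)"
  define b where "b = \<P>(\<omega> in M. y \<omega> \<and> \<not> z \<omega>)"
  define c where "c = \<P>(\<omega> in M. \<not> y \<omega> \<and> z \<omega>)"
  define d where "d = \<P>(\<omega> in M. \<not> y \<omega> \<and> \<not> z \<omega>)"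
  note defs = a_def b_def c_def d_def
  have nonneg: "a \<ge> 0" "b \<ge> 0" "c \<ge> 0" "d \<ge> 0"
    by (simp_all add: defs)
  have y: "\<P>(\<omega> in M. y \<omega>) = a + b" and ny: "\<P>(\<omega> in M. \<not> y \<omega>) = c + d"
    using prob_conj_split[of z y] prob_conj_split[of z "\<lambda>\<omega>. \<not> y \<omega>"]
    by (simp_all add: defs conj_commute)
  have z: "\<P>(\<omega> in M. z \<omega>) = a + c" and nz: "\<P>(\<omega> in M. \<not> z \<omega>) = b + d"
    using prob_conj_split[of y z] prob_conj_split[of y "\<lambda>\<omega>. \<not> z \<omega>"]
    by (simp_all add: defs)
  have pos: "a + c > 0" "b + d > 0"
    using rel by (simp_all add: stochastically_relevant_def z nz)
  have "b / (b + d) \<noteq> a / (a + c)"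
    using rel by (simp add: stochastically_relevant_def cond_prob_def z nz flip: a_def b_def)
  \<comment> \<open>Cross-multiplying gives \<open>b * (a + c) \<noteq> a * (b + d)\<close>, and
    \<open>a * b\<close> cancels.\<close>
  then have det: "a * d \<noteq> b * c"
    using pos by (auto simp: field_simps)
  \<comment> \<open>A row of total mass 0 has both cells 0, which would make the determinant
    vanish.\<close>
  have "a + b \<noteq> 0" "c + d \<noteq> 0"
    using det nonneg by (auto simp: add_nonneg_eq_0_iff)
  then have pos': "a + b > 0" "c + d > 0"
    using nonneg by linarith+
  then show "\<P>(\<omega> in M. y \<omega>) > 0" "\<P>(\<omega> in M. \<not> y \<omega>) > 0"
    by (simp_all add: y ny)
  \<comment> \<open>After clearing denominators, equality would reduce to
    \<open>b * c = a * d\<close>.\<close>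
  have "b / (a + b) + c / (c + d) \<noteq> 1"
    using pos' det by (auto simp: field_simps)
  then show "\<P>(\<omega> in M. \<not> z \<omega> \<bar> y \<omega>) + \<P>(\<omega> in M. z \<omega> \<bar> \<not> y \<omega>) \<noteq> 1"
    unfolding cond_prob_def y ny by (simp add: b_def c_def conj_commute)
qed

text \<open>Total probability over \<open>y\<close>: given \<open>y\<close>, the signal carries no
  further information on \<open>z\<close>, so the error rates given \<open>y\<close> alone can be
  weighted with the posterior of \<open>y\<close>.\<close>

lemma cond_prob_noisy_given_signal:
  assumes [measurable]: "Measurable.pred M y" "Measurable.pred M z"
      "Measurable.pred M (\<lambda>\<omega>. sig \<omega> = a)"
    and y: "\<P>(\<omega> in M. y \<omega>) > 0" "\<P>(\<omega> in M. \<not> y \<omega>) > 0"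
    and sig: "\<P>(\<omega> in M. sig \<omega> = a) > 0"
    and indep: "cond_indep_discrete M z sig y"
  shows "\<P>(\<omega> in M. z \<omega> \<bar> sig \<omega> = a) =
    (1 - \<P>(\<omega> in M. \<not> z \<omega> \<bar> y \<omega>)) * \<P>(\<omega> in M. y \<omega> \<bar> sig \<omega> = a) +
    \<P>(\<omega> in M. z \<omega> \<bar> \<not> y \<omega>) * (1 - \<P>(\<omega> in M. y \<omega> \<bar> sig \<omega> = a))"
proof -
  have "\<P>(\<omega> in M. z \<omega> = True \<and> sig \<omega> = a \<bar> y \<omega> = c) =
      \<P>(\<omega> in M. z \<omega> = True \<bar> y \<omega> = c) * \<P>(\<omega> in M. sig \<omega> = a \<bar> y \<omega> = c)"
    if "\<P>(\<omega> in M. y \<omega> = c) > 0" for c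
    using indep that unfolding cond_indep_discrete_def by blast
  from this[of True] this[of False]
  have "\<P>(\<omega> in M. y \<omega> \<and> z \<omega> \<and> sig \<omega> = a) =
        \<P>(\<omega> in M. z \<omega> \<bar> y \<omega>) * \<P>(\<omega> in M. y \<omega> \<and> sig \<omega> = a)"
    and "\<P>(\<omega> in M. \<not> y \<omega> \<and> z \<omega> \<and> sig \<omega> = a) =
        \<P>(\<omega> in M. z \<omega> \<bar> \<not> y \<omega>) * \<P>(\<omega> in M. \<not> y \<omega> \<and> sig \<omega> = a)"
    using y by (simp_all add: cond_prob_def field_simps conj_ac)
  moreover have "\<P>(\<omega> in M. z \<omega> \<and> sig \<omega> = a) =
      \<P>(\<omega> in M. y \<omega> \<and> z \<omega> \<and> sig \<omega> = a) + \<P>(\<omega> in M. \<not> y \<omega> \<and> z \<omega> \<and> sig \<omega> = a)"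
    by (rule prob_conj_split) measurable
  \<comment> \<open>Divide by the probability of the signal. The definition is unfolded only for
    conditioning on \<open>sig \<omega> = a\<close>, so the rates given \<open>y\<close> stay folded
    as factors.\<close>
  ultimately have "\<P>(\<omega> in M. z \<omega> \<bar> sig \<omega> = a) =
      \<P>(\<omega> in M. z \<omega> \<bar> y \<omega>) * \<P>(\<omega> in M. y \<omega> \<bar> sig \<omega> = a) +
      \<P>(\<omega> in M. z \<omega> \<bar> \<not> y \<omega>) * \<P>(\<omega> in M. \<not> y \<omega> \<bar> sig \<omega> = a)"
    by (simp add: cond_prob_def[of M _ "\<lambda>\<omega>. sig \<omega> = a"] add_divide_distrib)
  then show ?thesis
    using y sig by (simp add: cond_prob_not)
qed

end

theorem theorem4p6:
  fixes M :: "'a measure"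
    and y z :: "'a \<Rightarrow> bool"
    and sig :: "'a \<Rightarrow> 'o"
    and A :: "'o set"
    and R :: "real \<Rightarrow> real \<Rightarrow> real \<Rightarrow> bool \<Rightarrow> real"
    and ep em :: real
  assumes "prob_space M"
    and "y \<in> measurable M (count_space UNIV)"
    and "z \<in> measurable M (count_space UNIV)"
    and "finite A"
    and "sig \<in> measurable M (count_space A)"
    and "ep = \<P>(\<omega> in M. \<not> z \<omega> \<bar> y \<omega>)"
    and "em = \<P>(\<omega> in M. z \<omega> \<bar> \<not> y \<omega>)"
    and "cond_indep_discrete M z sig y"
    and "stochastically_relevant M z y"
    and "surrogate_scoring_rule R"
  shows "\<forall>a\<in>A. \<P>(\<omega> in M. sig \<omega> = a) > 0 \<longrightarrow>
    (let p\<^sub>i = \<P>(\<omega> in M. y \<omega> \<bar> sig \<omega> = a)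
     in \<forall>q\<^sub>i\<in>{0..1}. q\<^sub>i \<noteq> p\<^sub>i \<longrightarrow>
          event_expectation M (\<lambda>\<omega>. sig \<omega> = a) (\<lambda>\<omega>. R ep em p\<^sub>i (z \<omega>))
          > event_expectation M (\<lambda>\<omega>. sig \<omega> = a) (\<lambda>\<omega>. R ep em q\<^sub>i (z \<omega>)))"
proof -
  interpret prob_space M by fact
  have [measurable]: "Measurable.pred M y" "Measurable.pred M z"
    using assms(2,3) by simp_all
  note y_pos = stochastically_relevant_nondegenerate(1,2)[of y z, OF _ _ assms(9)]
  have rates: "ep \<in> {0..1}" "em \<in> {0..1}" "ep + em \<noteq> 1"
    unfolding assms(6,7)
    by (intro cond_prob_in_unit_interval stochastically_relevant_nondegenerate(3) assms(9); measurable)+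
  show ?thesis
    unfolding Let_def
  proof (intro ballI impI)
    fix a q
    assume a: "a \<in> A" and pos: "\<P>(\<omega> in M. sig \<omega> = a) > 0"
    let ?p = "\<P>(\<omega> in M. y \<omega> \<bar> sig \<omega> = a)"
    assume q: "q \<in> {0..1}" "q \<noteq> ?p"
    \<comment> \<open>The event is the preimage of \<open>{a}\<close>, a measurable set of
      \<open>count_space A\<close> because \<open>a \<in> A\<close>.\<close>
    have [measurable]: "Measurable.pred M (\<lambda>\<omega>. sig \<omega> = a)"
      using measurable_sets[OF assms(5), of "{a}"] a
      by (simp add: pred_def vimage_def Int_def conj_commute)
    have p: "?p \<in> {0..1}"
      by (rule cond_prob_in_unit_interval) measurable
    \<comment> \<open>Stated for an arbitrary report \<open>r\<close>, since it is used both for the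
      posterior and for \<open>q\<close>.\<close>
    have "event_expectation M (\<lambda>\<omega>. sig \<omega> = a) (\<lambda>\<omega>. R ep em r (z \<omega>)) =
        measure_pmf.expectation (noisy_pmf ep em ?p) (R ep em r)" for r
    proof -
      have "\<P>(\<omega> in M. z \<omega> \<bar> sig \<omega> = a) = (1 - ep) * ?p + em * (1 - ?p)"
        unfolding assms(6,7)
        by (intro cond_prob_noisy_given_signal y_pos pos assms(8); measurable)
      then show ?thesis
        unfolding noisy_pmf_eq_bernoulli[OF rates(1,2) p]
        by (subst event_expectation_bool) (use pos in simp_all)
    qed
    then show "event_expectation M (\<lambda>\<omega>. sig \<omega> = a) (\<lambda>\<omega>. R ep em ?p (z \<omega>))
        > event_expectation M (\<lambda>\<omega>. sig \<omega> = a) (\<lambda>\<omega>. R ep em q (z \<omega>))"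
      using surrogate_scoring_rule_strictly_proper[OF assms(10) p q rates] by simp
  qed
qed

end
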